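(* Let $M=\left\{(p_1,p_2,2)\in\mathbb{R}_+^3:\ \frac12=\frac1{p_1}+\frac1{p_2}\right\}$ and let $E_1,E_2,F$ be Banach spaces. Then $$\bigcup_{(p_1,p_2,2)\in M}\Pi_{(2;p_1,p_2)}(E_1,E_2;F)\subseteq\Pi_{bas}(E_1,E_2;F).$$
   Context: Banach spaces are over $\mathbb{K}=\mathbb{R}$ or $\mathbb{C}$; $\mathbb{R}_+$ denotes the positive reals; $E'$ is the topological dual of $E$ and $B_{E'}$ its closed unit ball. For a finite family, $\|(x_j)\|_{\ell_p^w(E)}=\sup_{\varphi\in B_{E'}}(\sum_j|\varphi(x_j)|^p)^{1/p}$. A continuous bilinear map $A\colon E_1\times E_2\to F$ is absolutely $(2;p_1,p_2)$-summing ($A\in\Pi_{(2;p_1,p_2)}(E_1,E_2;F)$) if there is $C>0$ such that $\big(\sum_{j=1}^m\|A(x_j^1,x_j^2)\|^2\big)^{1/2}\le C\prod_{i=1}^2\|(x_j^i)_{j=1}^m\|_{\ell_{p_i}^w(E_i)}$ for all finite families $x_1^i,\ldots,x_m^i\in E_i$, $i=1,2$. Rademacher functions: $r_j(t)=\mathrm{sign}(\sin2^j\pi t)$ on $[0,1]$, $j\ge0$. $Rad^{(2)}(F)$ is the space of families $(x_{i,j})_{i,j\ge0}\subseteq F$ with $$\|(x_{i,j})\|_{Rad^{(2)}(F)}=\sup_{m\ge0}\left(\int_0^1\Big\|\sum_{i,j=0}^m x_{i,j}r_i(t)r_j(t)\Big\|^2dt\right)^{1/2}<\infty$$ (finite families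 are extended by zero). A continuous bilinear map $A\colon E_1\times E_2\to F$ is bilinear almost summing ($A\in\Pi_{bas}(E_1,E_2;F)$) if there is $C>0$ such that $\|(A(x_i^1,x_j^2))_{i,j=0}^m\|_{Rad^{(2)}(F)}\le C\prod_{k=1}^2\|(x_j^k)_{j=0}^m\|_{\ell_2^w(E_k)}$ for all $m$ and all finite families $(x_j^k)_{j=0}^m\subseteq E_k$, $k=1,2$. *)

theory Defs
  imports "HOL-Analysis.Analysis"
begin

section \<open>The scalar field\<close>

text \<open>
  A type in this class is, up to an isometric isomorphism of real normed fields,
  either the reals or the complex numbers. (Such a map is automatically injective.)
\<close>

class real_or_complex = real_normed_field +
  assumes real_or_complex:
    "\<exists>f :: 'a \<Rightarrow> complex.
       (\<forall>x y. f (x + y) = f x + f y) \<and>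
       (\<forall>x y. f (x * y) = f x * f y) \<and>
       (\<forall>r x. f (r *\<^sub>R x) = r *\<^sub>R f x) \<and>
       (\<forall>x. norm (f x) = norm x) \<and>
       (range f = \<real> \<or> range f = UNIV)"

instance real :: real_or_complex
  by standard (rule exI[of _ complex_of_real], auto simp: Reals_def scaleR_conv_of_real)

instance complex :: real_or_complex
  by standard (rule exI[of _ "\<lambda>z. z"], auto)


section \<open>Banach spaces over the scalar field, duals and weak norms\<close>

text \<open>
  The type supplies addition, norm, completeness and the underlying real structure;
  the multiplication by scalars from \<open>'k\<close> is the parameter \<open>scale\<close>.
\<close>

locale banach_space = vector_space scale
  for scale :: "'k :: real_or_complex \<Rightarrow> 'a :: banach \<Rightarrow> 'a" +
  assumes norm_scale: "norm (scale c x) = norm c * norm x"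
    and scale_of_real: "scale (of_real r) x = r *\<^sub>R x"

definition dual :: "('k :: real_or_complex \<Rightarrow> 'a :: banach \<Rightarrow> 'a) \<Rightarrow> ('a \<Rightarrow> 'k) set" where
  "dual s = {\<phi>. Vector_Spaces.linear s (*) \<phi> \<and> continuous_on UNIV \<phi>}"

definition dual_ball :: "('k :: real_or_complex \<Rightarrow> 'a :: banach \<Rightarrow> 'a) \<Rightarrow> ('a \<Rightarrow> 'k) set" where
  "dual_ball s = {\<phi> \<in> dual s. onorm \<phi> \<le> 1}"

text \<open>
  The supremum is over a nonempty set of reals, bounded above for finite \<open>I\<close> and \<open>p > 0\<close>
  because \<open>norm (\<phi> (x j)) \<le> norm (x j)\<close>.
\<close>

definition weak_norm ::
  "('k :: real_or_complex \<Rightarrow> 'a :: banach \<Rightarrow> 'a) \<Rightarrow> real \<Rightarrow> 'i set \<Rightarrow> ('i \<Rightarrow> 'a) \<Rightarrow> real" where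
  "weak_norm s p I x = (SUP \<phi>\<in>dual_ball s. (\<Sum>j\<in>I. norm (\<phi> (x j)) powr p) powr (1 / p))"


section \<open>Classes of bilinear maps\<close>

definition cont_bilinear ::
  "('k :: real_or_complex \<Rightarrow> 'a :: banach \<Rightarrow> 'a) \<Rightarrow> ('k \<Rightarrow> 'b :: banach \<Rightarrow> 'b) \<Rightarrow>
   ('k \<Rightarrow> 'c :: banach \<Rightarrow> 'c) \<Rightarrow> ('a \<Rightarrow> 'b \<Rightarrow> 'c) set" where
  "cont_bilinear s1 s2 sF =
     {A. (\<forall>y. Vector_Spaces.linear s1 sF (\<lambda>x. A x y)) \<and>
         (\<forall>x. Vector_Spaces.linear s2 sF (\<lambda>y. A x y)) \<and>
         continuous_on UNIV (\<lambda>(x, y). A x y)}"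

text \<open>The absolutely \<open>(2; p1, p2)\<close>-summing maps.\<close>

definition abs_summing ::
  "('k :: real_or_complex \<Rightarrow> 'a :: banach \<Rightarrow> 'a) \<Rightarrow> ('k \<Rightarrow> 'b :: banach \<Rightarrow> 'b) \<Rightarrow>
   ('k \<Rightarrow> 'c :: banach \<Rightarrow> 'c) \<Rightarrow> real \<Rightarrow> real \<Rightarrow> ('a \<Rightarrow> 'b \<Rightarrow> 'c) set" where
  "abs_summing s1 s2 sF p1 p2 =
     {A \<in> cont_bilinear s1 s2 sF.
        \<exists>C>0. \<forall>(m::nat) x1 x2.
          sqrt (\<Sum>j=1..m. (norm (A (x1 j) (x2 j)))\<^sup>2)
            \<le> C * (weak_norm s1 p1 {1..m} x1 * weak_norm s2 p2 {1..m} x2)}"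

definition rademacher :: "nat \<Rightarrow> real \<Rightarrow> real" where
  "rademacher j t = sgn (sin (2 ^ j * pi * t))"

text \<open>
  The norm takes values in the extended nonnegative reals; the space consists of the
  families for which it is finite. The integrands are bounded step functions,
  hence always integrable.
\<close>

definition rad2_norm :: "(nat \<Rightarrow> nat \<Rightarrow> 'c :: banach) \<Rightarrow> ennreal" where
  "rad2_norm x =
     (SUP m. ennreal (sqrt (LINT t:{0..1}|lborel.
        (norm (\<Sum>i\<le>m. \<Sum>j\<le>m. (rademacher i t * rademacher j t) *\<^sub>R x i j))\<^sup>2)))"

definition Rad2 :: "(nat \<Rightarrow> nat \<Rightarrow> 'c :: banach) set" where
  "Rad2 = {x. rad2_norm x < \<infinity>}"

text \<open>Extension of the finite family indexed by \<open>{0..m} \<times> {0..m}\<close> by zero.\<close>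

definition zero_ext :: "nat \<Rightarrow> (nat \<Rightarrow> nat \<Rightarrow> 'c :: zero) \<Rightarrow> nat \<Rightarrow> nat \<Rightarrow> 'c" where
  "zero_ext m x = (\<lambda>i j. if i \<le> m \<and> j \<le> m then x i j else 0)"

text \<open>
  The bilinear almost summing maps. The bound is finite, so it includes the membership
  of the family in \<open>Rad2\<close>.
\<close>

definition almost_summing ::
  "('k :: real_or_complex \<Rightarrow> 'a :: banach \<Rightarrow> 'a) \<Rightarrow> ('k \<Rightarrow> 'b :: banach \<Rightarrow> 'b) \<Rightarrow>
   ('k \<Rightarrow> 'c :: banach \<Rightarrow> 'c) \<Rightarrow> ('a \<Rightarrow> 'b \<Rightarrow> 'c) set" where
  "almost_summing s1 s2 sF =
     {A \<in> cont_bilinear s1 s2 sF.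
        \<exists>C>0. \<forall>(m::nat) x1 x2.
          rad2_norm (zero_ext m (\<lambda>i j. A (x1 i) (x2 j)))
            \<le> ennreal (C * (weak_norm s1 2 {0..m} x1 * weak_norm s2 2 {0..m} x2))}"

definition exponents :: "(real \<times> real \<times> real) set" where
  "exponents = {(p1, p2, 2) | p1 p2. 0 < p1 \<and> 0 < p2 \<and> 1 / 2 = 1 / p1 + 1 / p2}"

end

theory Submission
  imports Defs
begin

text \<open>
  On each of the \<open>2 ^ m\<close> dyadic intervals the functions \<open>r\<^sub>0, \<dots>, r\<^sub>m\<close> are constant, so by
  bilinearity the Rademacher integral is the average of \<open>(norm (A (u k) (v k)))\<^sup>2\<close>, with \<open>u k\<close>
  and \<open>v k\<close> signed sums of the two families. As \<open>1/p1 + 1/p2 = 1/2\<close>, the averaging weight splits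
  into factors \<open>2 powr (- m / p1)\<close> and \<open>2 powr (- m / p2)\<close> absorbed by \<open>u\<close> and \<open>v\<close>. The summing
  inequality then applies to the weighted families, whose weak \<open>p1\<close>- and \<open>p2\<close>-norms are bounded
  by the weak 2-norms of the original ones through Khinchine's inequality for scalars. The latter
  follows from the exponential moment \<open>E (exp S + exp (- S)) = 2 * (\<Prod>i. cosh (a i))\<close>; adding
  both signs of the exponent compensates for \<open>r\<^sub>0\<close> being the constant 1.
\<close>

section \<open>Rademacher functions on dyadic intervals\<close>

text \<open>The value of the \<open>i\<close>-th Rademacher function on the open interval from
  \<open>k / 2 ^ m\<close> to \<open>(k + 1) / 2 ^ m\<close>, for \<open>i\<close> at most
  \<open>m\<close>: there \<open>2 ^ i * t\<close> has integer part
  \<open>k div 2 ^ (m - i)\<close>, whose parity decides the sign of the sine.\<close>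

definition dyadic_sign :: "nat \<Rightarrow> nat \<Rightarrow> nat \<Rightarrow> real" where
  "dyadic_sign m k i = (- 1) ^ (k div 2 ^ (m - i))"

lemma sgn_sin_pi_between:
  assumes "real q < s" "s < real q + 1"
  shows "sgn (sin (pi * s)) = (- 1) ^ q"
proof -
  have "pi * s = pi * (s - q) + pi * q"
    by (simp add: algebra_simps)
  then have "sin (pi * s) = sin (pi * (s - q)) * (- 1) ^ q"
    by (simp add: sin_add mult.commute[of pi "real q"])
  moreover have "sin (pi * (s - q)) > 0"
    using assms by (intro sin_gt_zero) auto
  ultimately show ?thesis
    by (cases "even q") (auto simp: sgn_mult)
qed

lemma rademacher_eq_dyadic_sign:
  assumes "real k / 2 ^ m < t" "t < (real k + 1) / 2 ^ m" "i \<le> m"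
  shows "rademacher i t = dyadic_sign m k i"
proof -
  define d :: nat where "d = 2 ^ (m - i)"
  define q where "q = k div d"
  have d: "d > 0" "(2::real) ^ m = 2 ^ i * real d"
    using \<open>i \<le> m\<close> by (auto simp: d_def simp flip: power_add)
  have t: "real k < 2 ^ i * t * d" "2 ^ i * t * d < real k + 1"
    using assms(1,2) by (simp_all add: field_simps d)
  \<comment> \<open>Integrality sharpens \<open>k < (q + 1) * d\<close> by one, so the whole dyadic
    interval lies between two consecutive zeros of the sine.\<close>
  have "q * d \<le> k" "k + 1 \<le> (q + 1) * d"
    using d(1) dividend_less_div_times[of d k] by (auto simp: q_def)
  then have k: "real q * d \<le> real k" "real k + 1 \<le> (real q + 1) * d"
    by (metis of_nat_le_iff of_nat_mult, metis of_nat_le_iff of_nat_mult of_nat_1 of_nat_add)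
  have "real q * d < (2 ^ i * t) * d" "(2 ^ i * t) * d < (real q + 1) * d"
    using k t by linarith+
  then have "real q < 2 ^ i * t" "2 ^ i * t < real q + 1"
    using d(1) by (simp_all add: mult_less_cancel_right)
  from sgn_sin_pi_between[OF this] show ?thesis
    by (simp add: rademacher_def dyadic_sign_def q_def d_def ac_simps)
qed

lemma in_dyadic_interval_iff:
  "t \<in> {real k / 2 ^ m..<(real k + 1) / 2 ^ m} \<longleftrightarrow> \<lfloor>t * 2 ^ m\<rfloor> = int k"
  by (auto simp: floor_eq_iff field_simps)

text \<open>
  The dyadic points form a countable null set, and discarding it requires no measurability of
  \<open>\<Phi>\<close>; this matters because norms of sums in a nonseparable Banach space are not
  covered by the measurability rules.
\<close>

lemma integral_dyadic:
  fixes \<Phi> :: "real \<Rightarrow> real"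
  assumes \<Phi>: "\<And>k t. k < 2 ^ m \<Longrightarrow> real k / 2 ^ m < t \<Longrightarrow> t < (real k + 1) / 2 ^ m \<Longrightarrow> \<Phi> t = h k"
  shows "(LINT t:{0..1}|lborel. \<Phi> t) = (\<Sum>k<2 ^ m. h k) / 2 ^ m"
proof -
  define I where "I k = {real k / 2 ^ m..<(real k + 1) / 2 ^ m}" for k
  define X where "X = range (\<lambda>k::nat. real k / 2 ^ m)"
  have emeas: "emeasure lborel (I k) = ennreal (1 / 2 ^ m)" for k
    by (simp add: I_def divide_right_mono flip: diff_divide_distrib)
  have sets: "I k \<in> sets borel" for k
    by (simp add: I_def)
  have eq: "indicat_real {0..1} t *\<^sub>R \<Phi> t = (\<Sum>k<2 ^ m. indicator (I k) t * h k)"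
    if "t \<notin> X" for t
  proof (cases "t \<in> {0..1}")
    case False
    have "t \<notin> I k" if "k < 2 ^ m" for k
    proof
      assume t: "t \<in> I k"
      have "real k + 1 \<le> 2 ^ m"
        using that by (metis Suc_leI numeral_power_eq_of_nat_cancel_iff of_nat_Suc of_nat_le_iff add.commute)
      then have "(real k + 1) / 2 ^ m \<le> 1" "real k / 2 ^ m \<ge> 0"
        by auto
      with t False show False
        by (auto simp: I_def)
    qed
    with False show ?thesis
      by simp
  next
    case True
    define n where "n = nat \<lfloor>t * 2 ^ m\<rfloor>"
    have n: "int n = \<lfloor>t * 2 ^ m\<rfloor>"
      using True by (simp add: n_def)
    have mem: "t \<in> I k \<longleftrightarrow> k = n" for k
      unfolding I_def in_dyadic_interval_iff n[symmetric] by auto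
    \<comment> \<open>The half-open intervals miss the endpoint 1; it lies in \<open>X\<close> as
      the point with \<open>k = 2 ^ m\<close>.\<close>
    have "t \<noteq> 1"
      using that rangeI[of "\<lambda>k::nat. real k / 2 ^ m" "2 ^ m"] by (auto simp: X_def)
    then have "t < 1"
      using True by auto
    have "real n \<le> t * 2 ^ m"
      using n by linarith
    also have "\<dots> < 2 ^ m"
      using \<open>t < 1\<close> by simp
    finally have "n < 2 ^ m"
      by (metis numeral_power_eq_of_nat_cancel_iff of_nat_less_iff)
    moreover have "t \<noteq> real n / 2 ^ m"
      using that by (auto simp: X_def)
    ultimately have "\<Phi> t = h n"
      using mem[of n] by (intro \<Phi>) (auto simp: I_def)
    then show ?thesis
      using True \<open>n < 2 ^ m\<close> by (simp add: indicator_def mem if_distrib if_distribR sum.delta cong: if_cong)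
  qed
  have "(LINT t:{0..1}|lborel. \<Phi> t) = (LINT t|lborel. (\<Sum>k<2 ^ m. indicator (I k) t * h k))"
    unfolding set_lebesgue_integral_def
    by (rule integral_discrete_difference[where X = X, OF _ _ _ eq]) (auto simp: X_def)
  also have "\<dots> = (\<Sum>k<2 ^ m. (LINT t|lborel. indicator (I k) t * h k))"
    by (intro Bochner_Integration.integral_sum integrable_mult_left integrable_real_indicator)
      (auto simp: emeas sets)
  also have "\<dots> = (\<Sum>k<2 ^ m. h k) / 2 ^ m"
    by (simp add: measure_def emeas sum_divide_distrib)
  finally show ?thesis .
qed


section \<open>Khinchine's inequality\<close>

text \<open>Termwise comparison of power series: after dropping the vanishing odd terms of cosh, it
  remains that \<open>fact n\<close> is at most \<open>fact (2 * n)\<close>.\<close>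

lemma cosh_le_exp_square: "cosh x \<le> exp (x\<^sup>2)" for x :: real
proof -
  have "(\<lambda>n. if even (2 * n) then x ^ (2 * n) /\<^sub>R fact (2 * n) else 0) sums cosh x"
    by (subst sums_mono_reindex[of "\<lambda>n. 2 * n"])
      (auto simp: strict_mono_def cosh_converges elim: evenE)
  moreover have "(\<lambda>n. (x\<^sup>2) ^ n /\<^sub>R fact n) sums exp (x\<^sup>2)"
    by (rule exp_converges)
  moreover have "(if even (2 * n) then x ^ (2 * n) /\<^sub>R fact (2 * n) else 0) \<le> (x\<^sup>2) ^ n /\<^sub>R fact n" for n
    by (auto simp: power_mult intro!: mult_right_mono le_imp_inverse_le fact_mono)
  ultimately show ?thesis
    by (rule sums_le[rotated])
qed

text \<open>Induction on \<open>m\<close>: interval \<open>k\<close> splits into halves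
  \<open>2 * k\<close> and \<open>2 * k + 1\<close>, which inherit the earlier signs and carry the
  new signs 1 and -1, so each step contributes a factor \<open>2 * cosh\<close>. The index 0 gives
  \<open>exp (a 0)\<close> because its sign is always 1.\<close>

lemma sum_exp_dyadic_sign:
  "(\<Sum>k<2 ^ m. exp (\<Sum>i\<le>m. dyadic_sign m k i * a i)) = 2 ^ m * exp (a 0) * (\<Prod>i=1..m. cosh (a i))"
proof (induction m)
  case 0
  show ?case by (simp add: dyadic_sign_def)
next
  case (Suc m)
  define S where "S k = (\<Sum>i\<le>m. dyadic_sign m k i * a i)" for k
  have refine: "dyadic_sign (Suc m) (2 * k + b) i = dyadic_sign m k i" if "i \<le> m" "b < 2" for k b i
    using that by (simp add: dyadic_sign_def Suc_diff_le div_mult2_eq)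
  have last: "dyadic_sign (Suc m) (2 * k) (Suc m) = 1" "dyadic_sign (Suc m) (2 * k + 1) (Suc m) = - 1" for k
    by (simp_all add: dyadic_sign_def)
  have even: "(\<Sum>i\<le>Suc m. dyadic_sign (Suc m) (2 * k) i * a i) = S k + a (Suc m)" for k
    using refine[of _ 0 k] last by (simp add: S_def)
  have odd: "(\<Sum>i\<le>Suc m. dyadic_sign (Suc m) (2 * k + 1) i * a i) = S k - a (Suc m)" for k
    using refine[of _ 1 k] last by (simp add: S_def)
  have pair: "exp (s + t) + exp (s - t) = exp s * (2 * cosh t)" for s t :: real
    using exp_add[of s t] exp_add[of s "- t"] by (simp add: cosh_def distrib_left)
  have split: "(\<Sum>k<2 * n. g k) = (\<Sum>k<n. g (2 * k) + g (2 * k + 1))" for g :: "nat \<Rightarrow> real" and n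
    by (induction n) simp_all
  have "(\<Sum>k<2 ^ Suc m. exp (\<Sum>i\<le>Suc m. dyadic_sign (Suc m) k i * a i))
      = (\<Sum>k<2 ^ m. exp (S k + a (Suc m)) + exp (S k - a (Suc m)))"
    unfolding power_Suc split even odd ..
  also have "\<dots> = (\<Sum>k<2 ^ m. exp (S k)) * (2 * cosh (a (Suc m)))"
    unfolding sum_distrib_right pair ..
  finally show ?case
    by (simp add: Suc.IH S_def)
qed

lemma sum_exp_dyadic_sign_le:
  "(\<Sum>k<2 ^ m. exp (\<Sum>i\<le>m. dyadic_sign m k i * a i) + exp (- (\<Sum>i\<le>m. dyadic_sign m k i * a i)))
     \<le> 2 ^ m * (2 * exp (\<Sum>i\<le>m. (a i)\<^sup>2))"
proof -
  have "(\<Sum>k<2 ^ m. exp (\<Sum>i\<le>m. dyadic_sign m k i * a i) + exp (- (\<Sum>i\<le>m. dyadic_sign m k i * a i)))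
      = 2 ^ m * (2 * (cosh (a 0) * (\<Prod>i=1..m. cosh (a i))))"
    using sum_exp_dyadic_sign[of m a] sum_exp_dyadic_sign[of m "\<lambda>i. - a i"]
    by (simp add: sum.distrib sum_negf cosh_def[of "a 0"] algebra_simps)
  \<comment> \<open>The two values \<open>exp (a 0)\<close> and \<open>exp (- a 0)\<close> have
    combined into the missing factor for index 0.\<close>
  also have "cosh (a 0) * (\<Prod>i=1..m. cosh (a i)) = (\<Prod>i\<le>m. cosh (a i))"
    by (simp add: prod.atLeast_Suc_atMost[of 0 m] flip: atLeast0AtMost)
  also have "\<dots> \<le> (\<Prod>i\<le>m. exp ((a i)\<^sup>2))"
    by (intro prod_mono) (simp add: cosh_le_exp_square)
  finally show ?thesis
    by (simp add: exp_sum)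
qed

text \<open>Raise \<open>u <= exp u\<close> with \<open>u = \<bar>s\<bar> / p\<close> to the power
  \<open>p\<close>.\<close>

lemma abs_powr_le_exp:
  fixes p s :: real
  assumes "p > 0"
  shows "\<bar>s\<bar> powr p \<le> p powr p * (exp s + exp (- s))"
proof -
  have "\<bar>s\<bar> / p \<le> exp (\<bar>s\<bar> / p)"
    using exp_ge_add_one_self[of "\<bar>s\<bar> / p"] by linarith
  then have "(\<bar>s\<bar> / p) powr p \<le> exp (\<bar>s\<bar> / p) powr p"
    using assms by (intro powr_mono2) auto
  also have "\<dots> = exp \<bar>s\<bar>"
    using assms by (simp add: powr_def)
  also have "\<dots> \<le> exp s + exp (- s)"
    by (cases "s \<ge> 0") auto
  finally show ?thesis
    using assms by (simp add: powr_divide field_simps)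
qed

text \<open>By homogeneity the coefficients may be normalised to have square sum 1; then the
  exponential moment is at most \<open>2 * exp 1\<close> on average and dominates the
  \<open>p\<close>-th moment up to the factor \<open>p powr p\<close>.\<close>

lemma khinchine_real:
  fixes a :: "nat \<Rightarrow> real"
  assumes "p > 0"
  shows "(\<Sum>k<2 ^ m. \<bar>\<Sum>i\<le>m. dyadic_sign m k i * a i\<bar> powr p)
    \<le> 2 ^ m * (2 * exp 1 * p powr p * sqrt (\<Sum>i\<le>m. (a i)\<^sup>2) powr p)"
proof -
  define \<sigma> where "\<sigma> = sqrt (\<Sum>i\<le>m. (a i)\<^sup>2)"
  define S where "S a k = (\<Sum>i\<le>m. dyadic_sign m k i * a i)" for a k
  show ?thesis
  proof (cases "\<sigma> = 0")
    case True
    then have "a i = 0" if "i \<le> m" for i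
      using that by (simp add: \<sigma>_def sum_nonneg_eq_0_iff)
    then show ?thesis
      by simp
  next
    case False
    then have \<sigma>: "\<sigma> > 0"
      by (simp add: \<sigma>_def sum_nonneg less_le)
    have S: "S a k = \<sigma> * S (\<lambda>i. a i / \<sigma>) k" for k
      using \<sigma> by (simp add: S_def sum_distrib_left)
    have one: "(\<Sum>i\<le>m. (a i / \<sigma>)\<^sup>2) = 1"
      using \<sigma> by (simp add: power_divide \<sigma>_def sum_nonneg flip: sum_divide_distrib)
    have "(\<Sum>k<2 ^ m. \<bar>S a k\<bar> powr p)
        \<le> (\<Sum>k<2 ^ m. \<sigma> powr p * p powr p * (exp (S (\<lambda>i. a i / \<sigma>) k) + exp (- S (\<lambda>i. a i / \<sigma>) k)))"
      unfolding S using \<sigma> abs_powr_le_exp[OF assms]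
      by (intro sum_mono) (simp add: abs_mult powr_mult mult.assoc)
    also have "\<dots> \<le> \<sigma> powr p * p powr p * (2 ^ m * (2 * exp 1))"
      using sum_exp_dyadic_sign_le[of m "\<lambda>i. a i / \<sigma>"] unfolding one S_def
      by (subst sum_distrib_left[symmetric]) (intro mult_left_mono, auto)
    finally show ?thesis
      by (simp add: S_def \<sigma>_def ac_simps)
  qed
qed

text \<open>Passing through the maximum of the two parts works for every positive \<open>p\<close>,
  below 1 as well as above.\<close>

lemma norm_complex_powr_le:
  assumes "p > 0"
  shows "norm z powr p \<le> 2 powr p * (\<bar>Re z\<bar> powr p + \<bar>Im z\<bar> powr p)"
proof -
  have "norm z powr p \<le> (2 * max \<bar>Re z\<bar> \<bar>Im z\<bar>) powr p"
    using assms cmod_le[of z] by (intro powr_mono2) auto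
  also have "\<dots> = 2 powr p * max \<bar>Re z\<bar> \<bar>Im z\<bar> powr p"
    by (simp add: powr_mult)
  also have "max \<bar>Re z\<bar> \<bar>Im z\<bar> powr p \<le> \<bar>Re z\<bar> powr p + \<bar>Im z\<bar> powr p"
    by (simp add: max_def)
  finally show ?thesis
    by simp
qed

text \<open>The real case gives \<open>2 * exp 1 * p powr p\<close>; the real and imaginary parts
  double it, and separating them costs \<open>2 powr p\<close>. The root allows the constant to
  stand inside the \<open>p\<close>-th power.\<close>

definition khinchine_const :: "real \<Rightarrow> real" where
  "khinchine_const p = (2 powr p * (2 * (2 * exp 1 * p powr p))) powr (1 / p)"

lemma khinchine_const_pos: "p > 0 \<Longrightarrow> khinchine_const p > 0"
  by (simp add: khinchine_const_def)

lemma khinchine_complex: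
  fixes a :: "nat \<Rightarrow> complex"
  assumes "p > 0"
  shows "(\<Sum>k<2 ^ m. norm (\<Sum>i\<le>m. dyadic_sign m k i *\<^sub>R a i) powr p)
    \<le> 2 ^ m * (khinchine_const p * sqrt (\<Sum>i\<le>m. (norm (a i))\<^sup>2)) powr p"
proof -
  define \<sigma> where "\<sigma> = sqrt (\<Sum>i\<le>m. (norm (a i))\<^sup>2)"
  define K where "K = 2 * exp 1 * p powr p"
  have K: "K > 0"
    using assms by (simp add: K_def)
  have part: "(\<Sum>k<2 ^ m. \<bar>\<Sum>i\<le>m. dyadic_sign m k i * b i\<bar> powr p) \<le> 2 ^ m * (K * \<sigma> powr p)"
    if "\<And>i. \<bar>b i\<bar> \<le> norm (a i)" for b
  proof -
    have "sqrt (\<Sum>i\<le>m. (b i)\<^sup>2) powr p \<le> \<sigma> powr p"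
      using assms that unfolding \<sigma>_def
      by (intro powr_mono2 real_sqrt_le_mono sum_mono) (auto simp: sum_nonneg abs_le_square_iff[symmetric])
    then have "2 ^ m * (K * sqrt (\<Sum>i\<le>m. (b i)\<^sup>2) powr p) \<le> 2 ^ m * (K * \<sigma> powr p)"
      using K by simp
    with khinchine_real[OF assms, of m b] show ?thesis
      unfolding K_def by linarith
  qed
  have "(\<Sum>k<2 ^ m. norm (\<Sum>i\<le>m. dyadic_sign m k i *\<^sub>R a i) powr p)
      \<le> 2 powr p * ((\<Sum>k<2 ^ m. \<bar>\<Sum>i\<le>m. dyadic_sign m k i * Re (a i)\<bar> powr p)
          + (\<Sum>k<2 ^ m. \<bar>\<Sum>i\<le>m. dyadic_sign m k i * Im (a i)\<bar> powr p))"
    using norm_complex_powr_le[OF assms, of "\<Sum>i\<le>m. dyadic_sign m _ i *\<^sub>R a i"]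
    by (simp flip: sum.distrib add: sum_distrib_left sum_mono)
  also have "\<dots> \<le> 2 powr p * (2 ^ m * (K * \<sigma> powr p) + 2 ^ m * (K * \<sigma> powr p))"
    using part[of "\<lambda>i. Re (a i)"] part[of "\<lambda>i. Im (a i)"]
    by (intro mult_left_mono add_mono) (auto simp: abs_Re_le_cmod abs_Im_le_cmod)
  also have "\<dots> = 2 ^ m * (khinchine_const p * \<sigma>) powr p"
    using assms K by (simp add: khinchine_const_def powr_mult powr_powr flip: K_def)
  finally show ?thesis
    by (simp add: \<sigma>_def)
qed

text \<open>The embedding of the scalars into the complex numbers is real-linear and isometric, so
  it commutes with the real signs and preserves both sides.\<close>

lemma khinchine:
  fixes a :: "nat \<Rightarrow> 'k :: real_or_complex"
  assumes "p > 0"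
  shows "(\<Sum>k<2 ^ m. norm (\<Sum>i\<le>m. dyadic_sign m k i *\<^sub>R a i) powr p)
    \<le> 2 ^ m * (khinchine_const p * sqrt (\<Sum>i\<le>m. (norm (a i))\<^sup>2)) powr p"
proof -
  obtain f :: "'k \<Rightarrow> complex"
    where f: "\<And>x y. f (x + y) = f x + f y" "\<And>r x. f (r *\<^sub>R x) = r *\<^sub>R f x" "\<And>x. norm (f x) = norm x"
    using real_or_complex by metis
  interpret f: linear f
    by (rule linearI) (fact f)+
  have "norm (\<Sum>i\<le>m. dyadic_sign m k i *\<^sub>R a i) = norm (\<Sum>i\<le>m. dyadic_sign m k i *\<^sub>R f (a i))" for k
    by (simp add: f(2) f.sum flip: f(3)[of "\<Sum>i\<le>m. dyadic_sign m k i *\<^sub>R a i"])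
  with khinchine_complex[OF assms, of m "\<lambda>i. f (a i)"] show ?thesis
    by (simp add: f(3))
qed


section \<open>Weak norms\<close>

text \<open>Restriction of scalars: the signs and weights are real, so only real linearity is used
  from here on.\<close>

lemma linear_scale_imp_linear:
  assumes "Vector_Spaces.linear s s' f"
    and "\<And>r x. s (of_real r) x = r *\<^sub>R x" and "\<And>r x. s' (of_real r) x = r *\<^sub>R x"
  shows "linear f"
proof -
  interpret f: Vector_Spaces.linear s s' f by fact
  show ?thesis
    by (rule linearI) (simp_all add: f.add f.scale flip: assms(2,3))
qed

lemma dual_imp_linear:
  assumes "banach_space s" "\<phi> \<in> dual s"
  shows "linear \<phi>"
  using assms linear_scale_imp_linear[of s "(*)" \<phi>]
  by (auto simp: dual_def banach_space.scale_of_real scaleR_conv_of_real)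

lemma bounded_linear_dual:
  assumes "banach_space s" "\<phi> \<in> dual s"
  shows "bounded_linear \<phi>"
proof -
  interpret linear \<phi>
    using assms by (rule dual_imp_linear)
  have "isCont \<phi> 0"
    using assms(2) by (simp add: dual_def continuous_on_eq_continuous_at)
  then obtain d where d: "d > 0" "\<And>x. norm x < d \<Longrightarrow> norm (\<phi> x) < 1"
    unfolding continuous_at_eps_delta by (auto simp: dist_norm zero dest: spec[of _ 1])
  have "norm (\<phi> x) \<le> norm x * (2 / d)" for x
  proof (cases "x = 0")
    case False
    \<comment> \<open>Rescales \<open>x\<close> to norm \<open>d / 2\<close>, inside the ball on
      which the functional stays below 1.\<close>
    define c where "c = d / (2 * norm x)"
    have c: "c > 0" "norm (c *\<^sub>R x) < d"
      using False d(1) by (simp_all add: c_def)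
    from d(2)[OF c(2)] have "c * norm (\<phi> x) < 1"
      using c(1) by (simp add: scale)
    with False d(1) show ?thesis
      by (simp add: c_def field_simps)
  qed (simp add: zero)
  then show ?thesis
    by unfold_locales blast
qed

lemma norm_dual_ball_le:
  assumes "banach_space s" "\<phi> \<in> dual_ball s"
  shows "norm (\<phi> x) \<le> norm x"
proof -
  have "norm (\<phi> x) \<le> onorm \<phi> * norm x"
    using assms by (intro onorm bounded_linear_dual) (auto simp: dual_ball_def)
  also have "\<dots> \<le> 1 * norm x"
    using assms by (intro mult_right_mono) (auto simp: dual_ball_def)
  finally show ?thesis
    by simp
qed

text \<open>Makes the supremum in \<open>weak_norm\<close> range over a nonempty set, and shows that
  it is nonnegative.\<close>

lemma zero_in_dual_ball:
  assumes "banach_space s"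
  shows "(\<lambda>_. 0) \<in> dual_ball s"
proof -
  interpret banach_space s by fact
  have "Vector_Spaces.linear s (*) (\<lambda>_. 0)"
    by unfold_locales (auto simp: algebra_simps)
  then show ?thesis
    by (simp add: dual_ball_def dual_def onorm_zero)
qed

lemma weak_norm_upper:
  assumes "banach_space s" "\<phi> \<in> dual_ball s" "p > 0"
  shows "(\<Sum>j\<in>I. norm (\<phi> (x j)) powr p) powr (1 / p) \<le> weak_norm s p I x"
  unfolding weak_norm_def
proof (rule cSUP_upper)
  show "bdd_above ((\<lambda>\<phi>. (\<Sum>j\<in>I. norm (\<phi> (x j)) powr p) powr (1 / p)) ` dual_ball s)"
    using assms norm_dual_ball_le[OF assms(1)]
    by (intro bdd_aboveI2[where M = "(\<Sum>j\<in>I. norm (x j) powr p) powr (1 / p)"] powr_mono2 sum_mono)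
      (auto simp: sum_nonneg)
qed fact

lemma weak_norm_least:
  assumes "banach_space s"
    and "\<And>\<phi>. \<phi> \<in> dual_ball s \<Longrightarrow> (\<Sum>j\<in>I. norm (\<phi> (x j)) powr p) powr (1 / p) \<le> B"
  shows "weak_norm s p I x \<le> B"
  unfolding weak_norm_def
  by (rule cSUP_least) (use zero_in_dual_ball[OF assms(1)] assms(2) in auto)

lemma weak_norm_nonneg:
  assumes "banach_space s" "p > 0"
  shows "weak_norm s p I x \<ge> 0"
  using weak_norm_upper[OF assms(1) zero_in_dual_ball[OF assms(1)] assms(2)] assms(2)
  by (metis order_trans powr_ge_zero)

lemma weak_norm_2_upper:
  assumes "banach_space s" "\<phi> \<in> dual_ball s"
  shows "sqrt (\<Sum>j\<in>I. (norm (\<phi> (x j)))\<^sup>2) \<le> weak_norm s 2 I x"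
  using weak_norm_upper[OF assms, of 2 x I] by (simp add: powr_half_sqrt sum_nonneg)

text \<open>For \<open>k < 2 ^ m\<close>, the value on the \<open>k\<close>-th dyadic interval of
  the Rademacher sum with coefficients \<open>x\<close>.\<close>

definition rad_sum :: "nat \<Rightarrow> (nat \<Rightarrow> 'a :: real_vector) \<Rightarrow> nat \<Rightarrow> 'a" where
  "rad_sum m x k = (\<Sum>i\<le>m. dyadic_sign m k i *\<^sub>R x i)"

text \<open>
  The factor \<open>2 powr (- m / p)\<close> turns the sum over the \<open>2 ^ m\<close> dyadic intervals
  into an average.
\<close>

lemma weak_norm_rad_sum_le:
  assumes s: "banach_space s" and "p > 0"
  shows "weak_norm s p {1..2 ^ m} (\<lambda>k. (2 powr (- real m / p)) *\<^sub>R rad_sum m x (k - 1))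
    \<le> khinchine_const p * weak_norm s 2 {..m} x"
proof (rule weak_norm_least[OF s])
  fix \<phi> assume \<phi>: "\<phi> \<in> dual_ball s"
  interpret linear \<phi>
    using s \<phi> by (intro dual_imp_linear) (auto simp: dual_ball_def)
  define \<sigma> where "\<sigma> = sqrt (\<Sum>i\<le>m. (norm (\<phi> (x i)))\<^sup>2)"
  have "(2 powr (- real m / p)) powr p = 2 powr (- real m)"
    using \<open>p > 0\<close> unfolding powr_powr by simp
  then have c: "(2 powr (- real m / p)) powr p * 2 ^ m = 1"
    by (simp add: powr_minus powr_realpow)
  \<comment> \<open>Summing families are indexed from 1 and dyadic intervals from 0, hence the shift
    by one.\<close>
  have "(\<Sum>k\<in>{1..2 ^ m}. norm (\<phi> ((2 powr (- real m / p)) *\<^sub>R rad_sum m x (k - 1))) powr p)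
      = (\<Sum>k<2 ^ m. norm (\<phi> ((2 powr (- real m / p)) *\<^sub>R rad_sum m x k)) powr p)"
    by (rule sum.reindex_bij_witness[of _ Suc "\<lambda>k. k - 1"]) auto
  also have "\<dots> = (2 powr (- real m / p)) powr p
      * (\<Sum>k<2 ^ m. norm (\<Sum>i\<le>m. dyadic_sign m k i *\<^sub>R \<phi> (x i)) powr p)"
    by (simp add: rad_sum_def scale sum powr_mult sum_distrib_left)
  also have "\<dots> \<le> (2 powr (- real m / p)) powr p * (2 ^ m * (khinchine_const p * \<sigma>) powr p)"
    unfolding \<sigma>_def using khinchine[OF \<open>p > 0\<close>] by (intro mult_left_mono) auto
  also have "\<dots> = (khinchine_const p * \<sigma>) powr p"
    using c by (simp flip: mult.assoc)
  finally have "(\<Sum>k\<in>{1..2 ^ m}. norm (\<phi> ((2 powr (- real m / p)) *\<^sub>R rad_sum m x (k - 1))) powr p) powr (1 / p)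
      \<le> ((khinchine_const p * \<sigma>) powr p) powr (1 / p)"
    using \<open>p > 0\<close> by (intro powr_mono2) (auto simp: sum_nonneg)
  also have "\<dots> = khinchine_const p * \<sigma>"
    using \<open>p > 0\<close> khinchine_const_pos[of p] by (simp add: powr_powr \<sigma>_def sum_nonneg)
  also have "\<dots> \<le> khinchine_const p * weak_norm s 2 {..m} x"
    unfolding \<sigma>_def using weak_norm_2_upper[OF s \<phi>] khinchine_const_pos[OF \<open>p > 0\<close>]
    by (intro mult_left_mono) auto
  finally show "(\<Sum>k\<in>{1..2 ^ m}. norm (\<phi> ((2 powr (- real m / p)) *\<^sub>R rad_sum m x (k - 1))) powr p) powr (1 / p)
      \<le> khinchine_const p * weak_norm s 2 {..m} x" .
qed

definition truncate :: "nat \<Rightarrow> (nat \<Rightarrow> 'a :: zero) \<Rightarrow> nat \<Rightarrow> 'a" where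
  "truncate m x i = (if i \<le> m then x i else 0)"

text \<open>The supremum in \<open>rad2_norm\<close> runs over all \<open>n\<close>, smaller or
  larger than \<open>m\<close>; extending by zero or cutting off never increases the weak
  norm.\<close>

lemma weak_norm_truncate_le:
  assumes s: "banach_space s"
  shows "weak_norm s 2 {..n} (truncate m x) \<le> weak_norm s 2 {0..m} x"
proof (rule weak_norm_least[OF s])
  fix \<phi> assume \<phi>: "\<phi> \<in> dual_ball s"
  interpret linear \<phi>
    using s \<phi> by (intro dual_imp_linear) (auto simp: dual_ball_def)
  have "(\<Sum>j\<le>n. norm (\<phi> (truncate m x j)) powr 2) = (\<Sum>j\<in>{..n} \<inter> {0..m}. norm (\<phi> (x j)) powr 2)"
    by (rule sum.mono_neutral_cong_right) (auto simp: truncate_def zero)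
  also have "\<dots> \<le> (\<Sum>j\<in>{0..m}. norm (\<phi> (x j)) powr 2)"
    by (rule sum_mono2) auto
  finally have "(\<Sum>j\<le>n. norm (\<phi> (truncate m x j)) powr 2) powr (1 / 2)
      \<le> (\<Sum>j\<in>{0..m}. norm (\<phi> (x j)) powr 2) powr (1 / 2)"
    by (intro powr_mono2) (auto simp: sum_nonneg)
  also have "\<dots> \<le> weak_norm s 2 {0..m} x"
    by (rule weak_norm_upper[OF s \<phi>]) simp
  finally show "(\<Sum>j\<le>n. norm (\<phi> (truncate m x j)) powr 2) powr (1 / 2) \<le> weak_norm s 2 {0..m} x" .
qed


section \<open>Bilinear maps\<close>

text \<open>Both signs are taken at the same \<open>t\<close>, so on each interval the double sum
  collapses to \<open>A\<close> at a pair of signed sums with a common index \<open>k\<close>. This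
  diagonal form is what a summing inequality can control.\<close>

lemma rademacher_average_bilinear:
  fixes A :: "'a :: real_vector \<Rightarrow> 'b :: real_vector \<Rightarrow> 'c :: real_normed_vector"
  assumes A1: "\<And>y. linear (\<lambda>x. A x y)" and A2: "\<And>x. linear (A x)"
  shows "(LINT t:{0..1}|lborel.
        (norm (\<Sum>i\<le>m. \<Sum>j\<le>m. (rademacher i t * rademacher j t) *\<^sub>R A (x i) (y j)))\<^sup>2)
    = (\<Sum>k<2 ^ m. (norm (A (rad_sum m x k) (rad_sum m y k)))\<^sup>2) / 2 ^ m"
proof (rule integral_dyadic)
  fix k t assume t: "real k / 2 ^ m < t" "t < (real k + 1) / 2 ^ m"
  have "A (rad_sum m x k) (rad_sum m y k)
      = (\<Sum>i\<le>m. \<Sum>j\<le>m. (dyadic_sign m k i * dyadic_sign m k j) *\<^sub>R A (x i) (y j))"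
    unfolding rad_sum_def
    by (simp add: linear_sum[OF A1] linear_cmul[OF A1] linear_sum[OF A2] linear_cmul[OF A2]
        scaleR_sum_right, subst sum.swap, simp add: mult.commute)
  then show "(norm (\<Sum>i\<le>m. \<Sum>j\<le>m. (rademacher i t * rademacher j t) *\<^sub>R A (x i) (y j)))\<^sup>2
      = (norm (A (rad_sum m x k) (rad_sum m y k)))\<^sup>2"
    by (simp add: rademacher_eq_dyadic_sign[OF t])
qed

lemma abs_summing_rademacher_le:
  assumes s1: "banach_space s1" and s2: "banach_space s2"
    and A1: "\<And>y. linear (\<lambda>x. A x y)" and A2: "\<And>x. linear (A x)"
    and p: "p1 > 0" "p2 > 0" "1 / 2 = 1 / p1 + 1 / p2"
    and "C > 0"
    and summing: "\<And>(n::nat) x1 x2. sqrt (\<Sum>j=1..n. (norm (A (x1 j) (x2 j)))\<^sup>2)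
            \<le> C * (weak_norm s1 p1 {1..n} x1 * weak_norm s2 p2 {1..n} x2)"
  shows "sqrt (LINT t:{0..1}|lborel.
        (norm (\<Sum>i\<le>m. \<Sum>j\<le>m. (rademacher i t * rademacher j t) *\<^sub>R A (x i) (y j)))\<^sup>2)
    \<le> C * khinchine_const p1 * khinchine_const p2 * (weak_norm s1 2 {..m} x * weak_norm s2 2 {..m} y)"
proof -
  define c1 c2 where "c1 = 2 powr (- real m / p1)" and "c2 = 2 powr (- real m / p2)"
  define u v where "u k = c1 *\<^sub>R rad_sum m x (k - 1)" and "v k = c2 *\<^sub>R rad_sum m y (k - 1)" for k
  \<comment> \<open>The relation between the exponents makes the two weights multiply to the square
    root of the interval length.\<close>
  have "- real m / p1 + - real m / p2 = - real m * (1 / p1 + 1 / p2)"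
    by (simp add: algebra_simps)
  then have "c1 * c2 = 2 powr (- real m / 2)"
    unfolding c1_def c2_def powr_add[symmetric] p(3)[symmetric] by simp
  then have "(c1 * c2)\<^sup>2 = 2 powr (- real m)"
    by (simp add: power2_eq_square flip: powr_add)
  then have c: "(c1 * c2)\<^sup>2 = 1 / 2 ^ m"
    by (simp add: powr_minus powr_realpow divide_inverse)
  have "(LINT t:{0..1}|lborel.
        (norm (\<Sum>i\<le>m. \<Sum>j\<le>m. (rademacher i t * rademacher j t) *\<^sub>R A (x i) (y j)))\<^sup>2)
      = (\<Sum>k<2 ^ m. (c1 * c2)\<^sup>2 * (norm (A (rad_sum m x k) (rad_sum m y k)))\<^sup>2)"
    unfolding rademacher_average_bilinear[of A, OF A1 A2] c by (simp add: sum_divide_distrib)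
  also have "\<dots> = (\<Sum>k=1..2 ^ m. (norm (A (u k) (v k)))\<^sup>2)"
    by (rule sum.reindex_bij_witness[of _ "\<lambda>k. k - 1" Suc])
      (auto simp: u_def v_def linear_cmul[OF A1] linear_cmul[OF A2] power_mult_distrib)
  finally have "sqrt (LINT t:{0..1}|lborel.
        (norm (\<Sum>i\<le>m. \<Sum>j\<le>m. (rademacher i t * rademacher j t) *\<^sub>R A (x i) (y j)))\<^sup>2)
      \<le> C * (weak_norm s1 p1 {1..2 ^ m} u * weak_norm s2 p2 {1..2 ^ m} v)"
    using summing[of u v "2 ^ m"] by simp
  also have "\<dots> \<le> C * ((khinchine_const p1 * weak_norm s1 2 {..m} x)
      * (khinchine_const p2 * weak_norm s2 2 {..m} y))"
    using weak_norm_rad_sum_le[OF s1 p(1), of m x] weak_norm_rad_sum_le[OF s2 p(2), of m y]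
      weak_norm_nonneg[OF s1] weak_norm_nonneg[OF s2] p \<open>C > 0\<close>
    unfolding u_def v_def c1_def c2_def
    by (intro mult_left_mono mult_mono) (auto intro!: mult_nonneg_nonneg less_imp_le[OF khinchine_const_pos])
  finally show ?thesis
    by (simp add: ac_simps)
qed

theorem theorem3p8:
  fixes s1 :: "'k :: real_or_complex \<Rightarrow> 'a :: banach \<Rightarrow> 'a"
    and s2 :: "'k \<Rightarrow> 'b :: banach \<Rightarrow> 'b"
    and sF :: "'k \<Rightarrow> 'c :: banach \<Rightarrow> 'c"
  assumes "banach_space s1" and "banach_space s2" and "banach_space sF"
  shows "(\<Union>(p1, p2, _)\<in>exponents. abs_summing s1 s2 sF p1 p2) \<subseteq> almost_summing s1 s2 sF"
proof
  fix A assume "A \<in> (\<Union>(p1, p2, _)\<in>exponents. abs_summing s1 s2 sF p1 p2)"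
  then obtain p1 p2 where p: "p1 > 0" "p2 > 0" "1 / 2 = 1 / p1 + 1 / p2"
    and A: "A \<in> abs_summing s1 s2 sF p1 p2"
    by (auto simp: exponents_def)
  from A have bil: "A \<in> cont_bilinear s1 s2 sF"
    by (simp add: abs_summing_def)
  from A obtain C where C: "C > 0" and
    summing: "\<And>(n::nat) x1 x2. sqrt (\<Sum>j=1..n. (norm (A (x1 j) (x2 j)))\<^sup>2)
            \<le> C * (weak_norm s1 p1 {1..n} x1 * weak_norm s2 p2 {1..n} x2)"
    by (auto simp: abs_summing_def)
  have A1: "linear (\<lambda>x. A x y)" for y
    using bil assms by (intro linear_scale_imp_linear[of s1 sF])
      (auto simp: cont_bilinear_def banach_space.scale_of_real)
  have A2: "linear (A x)" for x
    using bil assms by (intro linear_scale_imp_linear[of s2 sF])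
      (auto simp: cont_bilinear_def banach_space.scale_of_real)
  define K where "K = C * khinchine_const p1 * khinchine_const p2"
  have K: "K > 0"
    using C p khinchine_const_pos by (simp add: K_def)
  have "rad2_norm (zero_ext m (\<lambda>i j. A (x i) (y j)))
      \<le> ennreal (K * (weak_norm s1 2 {0..m} x * weak_norm s2 2 {0..m} y))" for m x y
    unfolding rad2_norm_def
  proof (intro SUP_least ennreal_leI)
    fix n
    \<comment> \<open>A bilinear map vanishes when either argument does, so the zero extension of
      the matrix comes from zero extensions of the two families, and the bound for full squares
      applies for every \<open>n\<close>.\<close>
    have ext: "zero_ext m (\<lambda>i j. A (x i) (y j)) i j = A (truncate m x i) (truncate m y j)" for i j
      by (simp add: zero_ext_def truncate_def linear_0[OF A1] linear_0[OF A2])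
    have "sqrt (LINT t:{0..1}|lborel. (norm (\<Sum>i\<le>n. \<Sum>j\<le>n.
          (rademacher i t * rademacher j t) *\<^sub>R zero_ext m (\<lambda>i j. A (x i) (y j)) i j))\<^sup>2)
        \<le> K * (weak_norm s1 2 {..n} (truncate m x) * weak_norm s2 2 {..n} (truncate m y))"
      unfolding ext K_def by (rule abs_summing_rademacher_le[OF assms(1,2) A1 A2 p C summing])
    also have "\<dots> \<le> K * (weak_norm s1 2 {0..m} x * weak_norm s2 2 {0..m} y)"
      using K weak_norm_nonneg[OF assms(1), of 2] weak_norm_nonneg[OF assms(2), of 2]
      by (intro mult_left_mono mult_mono weak_norm_truncate_le assms) auto
    finally show "sqrt (LINT t:{0..1}|lborel. (norm (\<Sum>i\<le>n. \<Sum>j\<le>n.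
          (rademacher i t * rademacher j t) *\<^sub>R zero_ext m (\<lambda>i j. A (x i) (y j)) i j))\<^sup>2)
        \<le> K * (weak_norm s1 2 {0..m} x * weak_norm s2 2 {0..m} y)" .
  qed
  with bil K show "A \<in> almost_summing s1 s2 sF"
    by (auto simp: almost_summing_def)
qed

end
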